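(* Let $(\mathbf X^1,\mathbf S^1,\mathbf V^1,\mathbf B^1)$ be obtained from $(\mathbf X^0,\mathbf S^0,\mathbf V^0,\mathbf B^0)$ by one step of size $\Delta t>0$ of the coupled-implicit dynamical low-rank scheme with conservative truncation defined in the context. Then the scheme is locally conservative. That is, for the scalar flux $\Phi^n_j=\sum_{\ell,m}X^n_{j\ell}S^n_{\ell m}V^n_{0m}$ at time $t_n$, $n\in\{0,1\}$, and $u^0_{jk}=\sum_{\ell,m}X^0_{j\ell}S^0_{\ell m}V^0_{km}$, the following conservation law holds for all $j=1,\dots,n_x$: $$\Phi^1_j=\Phi^0_j-\Delta t\sum_{i,\ell}D^x_{ji}u^0_{i\ell}A_{0\ell}+\Delta t\sum_{i,\ell}D^{xx}_{ji}u^0_{i\ell}|A|_{0\ell}+\sigma\Delta t(B^1_j-\Phi^1_j),$$ $$B^1_j=B^0_j+\sigma\Delta t(\Phi^1_j-B^1_j).$$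
   Context: Parameters: $n_x$ is the number of spatial cells, $N$ the number of angular moments (moment indices run over $0,\dots,N-1$), $\Delta x>0$ the grid spacing, $\sigma>0$ the constant opacity, $r$ the rank with $2r+1\le\min(n_x,N)$. $\|\cdot\|_E$ is the Euclidean norm. $\mathbf e_1\in\mathbb R^N$ is the first unit vector (corresponding to moment index $0$), $\mathbf I$ the identity. Angular matrices: $P_0,\dots,P_{N-1}$ are the Legendre polynomials normalized in $L^2([-1,1])$; $\mathbf A\in\mathbb R^{N\times N}$ is the symmetric matrix with entries $A_{mn}=\int_{-1}^1 P_m(\mu)\,\mu\,P_n(\mu)\,d\mu$; with an orthogonal diagonalization $\mathbf A=\mathbf Q\mathbf M\mathbf Q^\top$, set $|\mathbf A|=\mathbf Q|\mathbf M|\mathbf Q^\top$, with entries $|A|_{mn}$. Spatial stencil matrices in $\mathbb R^{n_x\times n_x}$ with periodic boundary conditions (indices modulo $n_x$): $D^x_{p,p\pm1}=\frac{\pm1}{2\Delta x}$; $D^{xx}_{p,p}=-\frac1{\Delta x}$, $D^{xx}_{p,p\pm1}=\frac1{2\Delta x}$; all other entries are zero. QR convention: the orthonormal factor of a QR-decomposition, also written $\mathrm{qr}(\cdot)$, has as many orthonormal columns as the decomposed matrix has columns, its column span contains the columns of that matrix, and its first column is the normalized first column of the matrix whenever that is nonzero. Scheme (one step). Given $\mathbf X^0\in\mathbb R^{n_x\times r}$ and $\mathbf V^0\in\mathbb R^{N\times r}$ with orthonormal columns, $\mathbf S^0\in\mathbb R^{r\times r}$, $\mathbf B^0\in\mathbb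 R^{n_x}$, put $\mathbf K^0=\mathbf X^0\mathbf S^0$, $\mathbf L^0=\mathbf V^0\mathbf S^{0,\top}$. 1. $\mathbf K^\star=\mathbf K^0-\Delta t\,\mathbf D^x\mathbf K^0\mathbf V^{0,\top}\mathbf A\mathbf V^0+\Delta t\,\mathbf D^{xx}\mathbf K^0\mathbf V^{0,\top}|\mathbf A|\mathbf V^0$ and $\mathbf L^\star=\mathbf L^0-\Delta t\,\mathbf A\mathbf L^0\mathbf X^{0,\top}(\mathbf D^x)^\top\mathbf X^0+\Delta t\,|\mathbf A|\mathbf L^0\mathbf X^{0,\top}(\mathbf D^{xx})^\top\mathbf X^0$. 2. $\mathbf X^\star\in\mathbb R^{n_x\times2r}$ and $\mathbf V^\star\in\mathbb R^{N\times2r}$ are the orthonormal QR factors of $[\mathbf K^\star,\mathbf X^0]$ and $[\mathbf L^\star,\mathbf V^0]$. 3. With $\widetilde{\mathbf S}^0=\mathbf X^{\star,\top}\mathbf X^0\mathbf S^0\mathbf V^{0,\top}\mathbf V^\star$, set $\mathbf S^\star=\widetilde{\mathbf S}^0-\Delta t\,\mathbf X^{\star,\top}\mathbf D^x\mathbf X^\star\widetilde{\mathbf S}^0\mathbf V^{\star,\top}\mathbf A\mathbf V^\star+\Delta t\,\mathbf X^{\star,\top}\mathbf D^{xx}\mathbf X^\star\widetilde{\mathbf S}^0\mathbf V^{\star,\top}|\mathbf A|\mathbf V^\star$. 4. Solve the coupled implicit system for $\widehat{\mathbf u}^1_0,\mathbf B^1\in\mathbb R^{n_x}$: $\widehat{\mathbf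 u}_0^1=\mathbf X^0\mathbf S^0\mathbf V^{0,\top}\mathbf e_1-\Delta t\,\mathbf D^x\mathbf X^\star\widetilde{\mathbf S}^0\mathbf V^{\star,\top}\mathbf A\mathbf e_1+\Delta t\,\mathbf D^{xx}\mathbf X^\star\widetilde{\mathbf S}^0\mathbf V^{\star,\top}|\mathbf A|\mathbf e_1+\sigma\Delta t(\mathbf B^1-\widehat{\mathbf u}_0^1)$, and $\mathbf B^1=\mathbf B^0+\sigma\Delta t(\widehat{\mathbf u}_0^1-\mathbf B^1)$. 5. Absorption: with $\mathbf L=\mathbf V^\star\mathbf S^{\star,\top}\in\mathbb R^{N\times2r}$, let $\mathbf L^{\star,\mathrm{scat}}$ have rows $L^{\star,\mathrm{scat}}_{mk}=\frac1{1+\sigma\Delta t}L_{mk}$ for moment indices $m\ne0$ and $L^{\star,\mathrm{scat}}_{0k}=L_{0k}$. A QR-decomposition $\mathbf V^{\star,\mathrm{scat}}\mathbf S^{\star,\mathrm{scat},\top}=\mathbf L^{\star,\mathrm{scat}}$ defines $\mathbf V^{\star,\mathrm{scat}}\in\mathbb R^{N\times2r}$ (orthonormal columns) and $\mathbf S^{\star,\mathrm{scat}}\in\mathbb R^{2r\times2r}$. 6. Augmentation: $\widetilde{\mathbf X}^1=\mathrm{qr}([\widehat{\mathbf u}_0^1,\mathbf X^\star])$, $\widetilde{\mathbf V}^1=\mathrm{qr}([\mathbf e_1,\mathbf V^{\star,\mathrm{scat}}])$. 7. Correction: $\widetilde{\mathbf S}^1=\widetilde{\mathbf X}^{1,\top}\mathbf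 X^\star\mathbf S^{\star,\mathrm{scat}}\mathbf V^{\star,\mathrm{scat},\top}(\mathbf I-\mathbf e_1\mathbf e_1^\top)\widetilde{\mathbf V}^1+\widetilde{\mathbf X}^{1,\top}\widehat{\mathbf u}_0^1\mathbf e_1^\top\widetilde{\mathbf V}^1\in\mathbb R^{(2r+1)\times(2r+1)}$. 8. Conservative truncation with tolerance $\vartheta\ge 0$: write $\widetilde{\mathbf K}=\widetilde{\mathbf X}^1\widetilde{\mathbf S}^1=[\widetilde{\mathbf K}^{\mathrm{cons}},\widetilde{\mathbf K}^{\mathrm{rem}}]$ and $\widetilde{\mathbf V}^1=[\widetilde{\mathbf V}^{\mathrm{cons}},\widetilde{\mathbf V}^{\mathrm{rem}}]$, where "cons" is the first column and "rem" the remaining $2r$ columns. Put $\mathbf S^{\mathrm{cons}}=\|\widetilde{\mathbf K}^{\mathrm{cons}}\|_E$ and $\mathbf X^{\mathrm{cons}}=\widetilde{\mathbf K}^{\mathrm{cons}}/\|\widetilde{\mathbf K}^{\mathrm{cons}}\|_E$ (any unit vector if $\widetilde{\mathbf K}^{\mathrm{cons}}=0$). Take a QR-decomposition $\widetilde{\mathbf K}^{\mathrm{rem}}=\widetilde{\mathbf X}^{\mathrm{rem}}\widetilde{\mathbf S}^{\mathrm{rem}}$ and a singular value decomposition $\widetilde{\mathbf S}^{\mathrm{rem}}=\mathbf U\mathbf\Sigma\mathbf W^\top$, $\mathbf\Sigma=\mathrm{diag}(\sigma_j)$; choose $r_1\le2r$ minimal with $(\sum_{j=r_1+1}^{2r}\sigma_j^2)^{1/2}\le\vartheta$;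 let $\mathbf S^{\mathrm{rem}}$ be the diagonal matrix of the $r_1$ largest singular values and $\mathbf U^{\mathrm{rem}},\mathbf W^{\mathrm{rem}}$ the first $r_1$ columns of $\mathbf U,\mathbf W$; set $\mathbf X^{\mathrm{rem}}=\widetilde{\mathbf X}^{\mathrm{rem}}\mathbf U^{\mathrm{rem}}$, $\mathbf V^{\mathrm{rem}}=\widetilde{\mathbf V}^{\mathrm{rem}}\mathbf W^{\mathrm{rem}}$. With QR-decompositions $[\mathbf X^{\mathrm{cons}},\mathbf X^{\mathrm{rem}}]=\mathbf X^1\mathbf R^1$ and $[\mathbf e_1,\mathbf V^{\mathrm{rem}}]=\mathbf V^1\mathbf R^2$, set $\mathbf S^1=\mathbf R^1\begin{bmatrix}\mathbf S^{\mathrm{cons}}&0\\0&\mathbf S^{\mathrm{rem}}\end{bmatrix}\mathbf R^{2,\top}$. *)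

theory Defs
  imports
    "HOL-Analysis.Henstock_Kurzweil_Integration"
    "Jordan_Normal_Form.VS_Connect"
begin

text \<open>Matrices and vectors are those of \<open>Jordan_Normal_Form\<close>, so all row, column and moment
  indices start at 0.\<close>

text \<open>Rodrigues' formula.\<close>

definition legendre :: "nat \<Rightarrow> real poly" where
  "legendre n = Polynomial.smult (1 / (2 ^ n * fact n)) ((pderiv ^^ n) ([:-1, 0, 1:] ^ n))"

definition legendre_normalized :: "nat \<Rightarrow> real \<Rightarrow> real" where
  "legendre_normalized n \<mu> =
     poly (legendre n) \<mu> / sqrt (integral {-1..1} (\<lambda>x. (poly (legendre n) x)\<^sup>2))"

definition angular_matrix :: "nat \<Rightarrow> real mat" where
  "angular_matrix N = mat N N (\<lambda>(m, n).
     integral {-1..1} (\<lambda>\<mu>. legendre_normalized m \<mu> * \<mu> * legendre_normalized n \<mu>))"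

definition orthonormal_cols :: "real mat \<Rightarrow> bool" where
  "orthonormal_cols Q \<longleftrightarrow> Q\<^sup>T * Q = 1\<^sub>m (dim_col Q)"

definition orthogonal_diagonalization :: "nat \<Rightarrow> real mat \<Rightarrow> real mat \<Rightarrow> real mat \<Rightarrow> bool" where
  "orthogonal_diagonalization N A Q M \<longleftrightarrow>
     Q \<in> carrier_mat N N \<and> orthonormal_cols Q \<and>
     M \<in> carrier_mat N N \<and> diagonal_mat M \<and>
     A = Q * M * Q\<^sup>T"

text \<open>The stencil contributions are added up. For \<open>n \<ge> 3\<close> the three positions
  \<open>p\<close>, \<open>p + 1\<close>, \<open>p - 1\<close> are distinct modulo \<open>n\<close> and each entry gets at most one contribution.\<close>

definition Dx_mat :: "nat \<Rightarrow> real \<Rightarrow> real mat" where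
  "Dx_mat n dx = mat n n (\<lambda>(p, q).
     (if q = (p + 1) mod n then 1 / (2 * dx) else 0)
     + (if p = (q + 1) mod n then - 1 / (2 * dx) else 0))"

definition Dxx_mat :: "nat \<Rightarrow> real \<Rightarrow> real mat" where
  "Dxx_mat n dx = mat n n (\<lambda>(p, q).
     (if q = p then - 1 / dx else 0)
     + (if q = (p + 1) mod n then 1 / (2 * dx) else 0)
     + (if p = (q + 1) mod n then 1 / (2 * dx) else 0))"

definition euclid_norm :: "real vec \<Rightarrow> real" where
  "euclid_norm v = L2_set (\<lambda>i. v $ i) {..<dim_vec v}"

definition outer_prod :: "real vec \<Rightarrow> real vec \<Rightarrow> real mat" where
  "outer_prod v w = mat (dim_vec v) (dim_vec w) (\<lambda>(i, j). v $ i * w $ j)"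

definition hcat :: "real mat \<Rightarrow> real mat \<Rightarrow> real mat" where
  "hcat A B = mat_of_cols (dim_row A) (cols A @ cols B)"

definition prepend_col :: "real vec \<Rightarrow> real mat \<Rightarrow> real mat" where
  "prepend_col v B = mat_of_cols (dim_vec v) (v # cols B)"

definition drop_first_col :: "real mat \<Rightarrow> real mat" where
  "drop_first_col A = mat_of_cols (dim_row A) (tl (cols A))"

definition take_cols :: "nat \<Rightarrow> real mat \<Rightarrow> real mat" where
  "take_cols k A = mat_of_cols (dim_row A) (take k (cols A))"

text \<open>\<open>M\<close> may be rank deficient, so the orthonormal factor is not determined by \<open>M\<close>; hence
  relations, not functions.\<close>

definition qr_factor :: "real mat \<Rightarrow> real mat \<Rightarrow> bool" where
  "qr_factor M Q \<longleftrightarrow>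
     Q \<in> carrier_mat (dim_row M) (dim_col M) \<and> orthonormal_cols Q \<and>
     set (cols M) \<subseteq> vec_space.col_space (dim_row M) Q \<and>
     (0 < dim_col M \<and> col M 0 \<noteq> 0\<^sub>v (dim_row M) \<longrightarrow>
        col Q 0 = (1 / euclid_norm (col M 0)) \<cdot>\<^sub>v col M 0)"

definition qr_decomposition :: "real mat \<Rightarrow> real mat \<Rightarrow> real mat \<Rightarrow> bool" where
  "qr_decomposition M Q R \<longleftrightarrow>
     qr_factor M Q \<and> R \<in> carrier_mat (dim_col M) (dim_col M) \<and> M = Q * R"

definition sv_decomposition ::
    "nat \<Rightarrow> real mat \<Rightarrow> real mat \<Rightarrow> (nat \<Rightarrow> real) \<Rightarrow> real mat \<Rightarrow> bool" where
  "sv_decomposition n M U sv W \<longleftrightarrow>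
     U \<in> carrier_mat n n \<and> orthonormal_cols U \<and>
     W \<in> carrier_mat n n \<and> orthonormal_cols W \<and>
     (\<forall>i<n. 0 \<le> sv i) \<and> (\<forall>i j. i \<le> j \<and> j < n \<longrightarrow> sv j \<le> sv i) \<and>
     M = U * mat_diag n sv * W\<^sup>T"

text \<open>Throughout, \<open>A\<close> and \<open>absA\<close> stand for the angular matrix and its absolute value,
  \<open>Dx\<close> and \<open>Dxx\<close> for the stencil matrices.\<close>

definition K_step ::
    "real \<Rightarrow> real mat \<Rightarrow> real mat \<Rightarrow> real mat \<Rightarrow> real mat \<Rightarrow>
     real mat \<Rightarrow> real mat \<Rightarrow> real mat \<Rightarrow> real mat" where
  "K_step dt Dx Dxx A absA X0 S0 V0 =
     (let K0 = X0 * S0 in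
      K0 - dt \<cdot>\<^sub>m (Dx * K0 * V0\<^sup>T * A * V0) + dt \<cdot>\<^sub>m (Dxx * K0 * V0\<^sup>T * absA * V0))"

definition L_step ::
    "real \<Rightarrow> real mat \<Rightarrow> real mat \<Rightarrow> real mat \<Rightarrow> real mat \<Rightarrow>
     real mat \<Rightarrow> real mat \<Rightarrow> real mat \<Rightarrow> real mat" where
  "L_step dt Dx Dxx A absA X0 S0 V0 =
     (let L0 = V0 * S0\<^sup>T in
      L0 - dt \<cdot>\<^sub>m (A * L0 * X0\<^sup>T * Dx\<^sup>T * X0) + dt \<cdot>\<^sub>m (absA * L0 * X0\<^sup>T * Dxx\<^sup>T * X0))"

definition S_projected ::
    "real mat \<Rightarrow> real mat \<Rightarrow> real mat \<Rightarrow> real mat \<Rightarrow> real mat \<Rightarrow> real mat" where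
  "S_projected X0 S0 V0 Xs Vs = Xs\<^sup>T * X0 * S0 * V0\<^sup>T * Vs"

definition S_step ::
    "real \<Rightarrow> real mat \<Rightarrow> real mat \<Rightarrow> real mat \<Rightarrow> real mat \<Rightarrow>
     real mat \<Rightarrow> real mat \<Rightarrow> real mat \<Rightarrow> real mat" where
  "S_step dt Dx Dxx A absA Xs St0 Vs =
     St0 - dt \<cdot>\<^sub>m (Xs\<^sup>T * Dx * Xs * St0 * Vs\<^sup>T * A * Vs)
         + dt \<cdot>\<^sub>m (Xs\<^sup>T * Dxx * Xs * St0 * Vs\<^sup>T * absA * Vs)"

definition coupled_implicit_system ::
    "real \<Rightarrow> real \<Rightarrow> real mat \<Rightarrow> real mat \<Rightarrow> real mat \<Rightarrow> real mat \<Rightarrow>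
     real mat \<Rightarrow> real mat \<Rightarrow> real mat \<Rightarrow> real mat \<Rightarrow> real mat \<Rightarrow> real mat \<Rightarrow>
     real vec \<Rightarrow> real vec \<Rightarrow> real vec \<Rightarrow> bool" where
  "coupled_implicit_system \<sigma> dt Dx Dxx A absA X0 S0 V0 Xs St0 Vs B0 u B1 \<longleftrightarrow>
     (let e1 = unit_vec (dim_row V0) 0 in
      u \<in> carrier_vec (dim_row X0) \<and> B1 \<in> carrier_vec (dim_row X0) \<and>
      u = (X0 * S0 * V0\<^sup>T) *\<^sub>v e1
          - dt \<cdot>\<^sub>v ((Dx * Xs * St0 * Vs\<^sup>T * A) *\<^sub>v e1)
          + dt \<cdot>\<^sub>v ((Dxx * Xs * St0 * Vs\<^sup>T * absA) *\<^sub>v e1)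
          + (\<sigma> * dt) \<cdot>\<^sub>v (B1 - u) \<and>
      B1 = B0 + (\<sigma> * dt) \<cdot>\<^sub>v (u - B1))"

definition L_scat :: "real \<Rightarrow> real \<Rightarrow> real mat \<Rightarrow> real mat" where
  "L_scat \<sigma> dt L = mat (dim_row L) (dim_col L) (\<lambda>(m, k).
     if m = 0 then L $$ (m, k) else 1 / (1 + \<sigma> * dt) * L $$ (m, k))"

definition S_corrected ::
    "real mat \<Rightarrow> real mat \<Rightarrow> real mat \<Rightarrow> real vec \<Rightarrow> real mat \<Rightarrow> real mat \<Rightarrow> real mat" where
  "S_corrected Xs Sscat Vscat u Xt1 Vt1 =
     (let N = dim_row Vscat; e1 = unit_vec N 0 in
      Xt1\<^sup>T * Xs * Sscat * Vscat\<^sup>T * (1\<^sub>m N - outer_prod e1 e1) * Vt1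
      + Xt1\<^sup>T * outer_prod u e1 * Vt1)"

text \<open>The singular values are indexed from 0, so those discarded for rank \<open>k\<close> have
  indices \<open>k, \<dots>, n - 1\<close>.\<close>

definition truncation_rank :: "nat \<Rightarrow> real \<Rightarrow> (nat \<Rightarrow> real) \<Rightarrow> nat" where
  "truncation_rank n \<theta> sv = (LEAST k. k \<le> n \<and> sqrt (\<Sum>j = k..<n. (sv j)\<^sup>2) \<le> \<theta>)"

definition conservative_truncation ::
    "nat \<Rightarrow> real \<Rightarrow> real mat \<Rightarrow> real mat \<Rightarrow> real mat \<Rightarrow>
     real mat \<Rightarrow> real mat \<Rightarrow> real mat \<Rightarrow> bool" where
  "conservative_truncation r \<theta> Xt1 St1 Vt1 X1 S1 V1 \<longleftrightarrow>
     (let nx = dim_row Xt1; N = dim_row Vt1;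
          Kt = Xt1 * St1;
          Kcons = col Kt 0; Krem = drop_first_col Kt;
          Vrem_t = drop_first_col Vt1;
          Scons = euclid_norm Kcons
      in \<exists>Xcons Xrem_t Srem_t U sv W R1 R2.
        Xcons \<in> carrier_vec nx \<and> euclid_norm Xcons = 1 \<and>
        (Kcons \<noteq> 0\<^sub>v nx \<longrightarrow> Xcons = (1 / euclid_norm Kcons) \<cdot>\<^sub>v Kcons) \<and>
        qr_decomposition Krem Xrem_t Srem_t \<and>
        sv_decomposition (2 * r) Srem_t U sv W \<and>
        (let r1 = truncation_rank (2 * r) \<theta> sv;
             Srem = mat_diag r1 sv;
             Xrem = Xrem_t * take_cols r1 U;
             Vrem = Vrem_t * take_cols r1 W
         in qr_decomposition (prepend_col Xcons Xrem) X1 R1 \<and>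
            qr_decomposition (prepend_col (unit_vec N 0) Vrem) V1 R2 \<and>
            S1 = R1 * four_block_mat (mat 1 1 (\<lambda>_. Scons)) (0\<^sub>m 1 r1)
                                     (0\<^sub>m r1 1) Srem * R2\<^sup>T))"

definition scheme_step ::
    "nat \<Rightarrow> nat \<Rightarrow> nat \<Rightarrow> real \<Rightarrow> real \<Rightarrow> real \<Rightarrow>
     real mat \<Rightarrow> real mat \<Rightarrow> real mat \<Rightarrow> real mat \<Rightarrow>
     real mat \<Rightarrow> real mat \<Rightarrow> real mat \<Rightarrow> real vec \<Rightarrow>
     real mat \<Rightarrow> real mat \<Rightarrow> real mat \<Rightarrow> real vec \<Rightarrow> bool" where
  "scheme_step nx N r \<sigma> dt \<theta> Dx Dxx A absA X0 S0 V0 B0 X1 S1 V1 B1 \<longleftrightarrow>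
     (\<exists>Xs Vs Ss St0 u Vscat Sscat Xt1 Vt1 St1.
        qr_factor (hcat (K_step dt Dx Dxx A absA X0 S0 V0) X0) Xs \<and>
        qr_factor (hcat (L_step dt Dx Dxx A absA X0 S0 V0) V0) Vs \<and>
        St0 = S_projected X0 S0 V0 Xs Vs \<and>
        Ss = S_step dt Dx Dxx A absA Xs St0 Vs \<and>
        coupled_implicit_system \<sigma> dt Dx Dxx A absA X0 S0 V0 Xs St0 Vs B0 u B1 \<and>
        Sscat \<in> carrier_mat (2 * r) (2 * r) \<and>
        qr_decomposition (L_scat \<sigma> dt (Vs * Ss\<^sup>T)) Vscat (Sscat\<^sup>T) \<and>
        qr_factor (prepend_col u Xs) Xt1 \<and>
        qr_factor (prepend_col (unit_vec N 0) Vscat) Vt1 \<and>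
        St1 = S_corrected Xs Sscat Vscat u Xt1 Vt1 \<and>
        conservative_truncation r \<theta> Xt1 St1 Vt1 X1 S1 V1)"

definition solution_entry :: "real mat \<Rightarrow> real mat \<Rightarrow> real mat \<Rightarrow> nat \<Rightarrow> nat \<Rightarrow> real" where
  "solution_entry X S V j k =
     (\<Sum>l<dim_col X. \<Sum>m<dim_col V. X $$ (j, l) * S $$ (l, m) * V $$ (k, m))"

definition scalar_flux :: "real mat \<Rightarrow> real mat \<Rightarrow> real mat \<Rightarrow> nat \<Rightarrow> real" where
  "scalar_flux X S V j =
     (\<Sum>l<dim_col X. \<Sum>m<dim_col V. X $$ (j, l) * S $$ (l, m) * V $$ (0, m))"

end

theory Submission
  imports Defs
begin

text \<open>The augmented bases contain the old ones, so projecting loses nothing: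
  \<open>X\<^sup>\<star> S' V\<^sup>\<star>\<^sup>T = X\<^sup>0 S\<^sup>0 V\<^sup>0\<^sup>T\<close> with the projected core \<open>S'\<close>, and the coupled implicit
  system for \<open>u\<close> is already the claimed law with \<open>u\<close> in place of the new flux. It remains to see that
  the new flux is \<open>u\<close>. Since \<open>e\<^sub>1\<close> is the first basis vector of the augmented \<open>V\<close>, the first column of
  the corrected coefficients is the coordinate vector of \<open>u\<close> in the augmented \<open>X\<close>, whose span
  contains \<open>u\<close>. The truncation only alters the other columns, which are orthogonal to \<open>e\<^sub>1\<close>.\<close>

unbundle no vec_syntax

section \<open>Matrix and vector algebra\<close>

lemma mult_mat_unit_vec:
  fixes A :: "real mat"
  assumes "A \<in> carrier_mat n m" and "i < m"
  shows "A *\<^sub>v unit_vec m i = col A i"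
  using assms by (intro eq_vecI) auto

lemma mult_mat_zero_vec:
  fixes A :: "real mat"
  shows "A \<in> carrier_mat n m \<Longrightarrow> A *\<^sub>v 0\<^sub>v m = 0\<^sub>v n"
  by (intro eq_vecI) auto

text \<open>With dimension equations as premises instead of carrier sets, every dimension is
  determined by the matrices themselves, so the rule serves as a conditional rewrite to the
  right-associated form.\<close>

lemma assoc_mult_mat_dim:
  fixes A :: "real mat"
  assumes "dim_col A = dim_row B" and "dim_col B = dim_row C"
  shows "A * B * C = A * (B * C)"
  using assms by (intro assoc_mult_mat[of _ "dim_row A" "dim_row B" _ "dim_row C" _ "dim_col C"]) auto

lemma transpose_mult_dim:
  fixes A :: "real mat"
  assumes "dim_col A = dim_row B"
  shows "(A * B)\<^sup>T = B\<^sup>T * A\<^sup>T"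
  using assms by (intro transpose_mult[of _ "dim_row A" "dim_row B" _ "dim_col B"]) auto

text \<open>Gives the symmetry of \<open>absA\<close>, where the middle factor is the diagonal
  matrix of absolute eigenvalues.\<close>

lemma symmetric_congruence:
  fixes A :: "real mat"
  assumes "B \<in> carrier_mat n n" and "A\<^sup>T = A" and "A \<in> carrier_mat n n"
  shows "(B * A * B\<^sup>T)\<^sup>T = B * A * B\<^sup>T"
  using assms by (simp add: transpose_mult_dim assoc_mult_mat_dim)

section \<open>Projection onto the span of orthonormal columns\<close>

text \<open>A vector of the column space is \<open>Q *\<^sub>v x\<close>, and orthonormality lets
  the transpose of \<open>Q\<close> recover the coordinates \<open>x\<close>.\<close>

lemma orthonormal_cols_projection:
  assumes Q: "Q \<in> carrier_mat n m" "orthonormal_cols Q" and v: "v \<in> vec_space.col_space n Q"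
  shows "Q *\<^sub>v (Q\<^sup>T *\<^sub>v v) = v"
proof -
  obtain x where x: "x \<in> carrier_vec m" and v_eq: "v = Q *\<^sub>v x"
    using v Q(1) vec_space.col_space_eq[OF Q(1)] by auto
  have "Q\<^sup>T *\<^sub>v v = (Q\<^sup>T * Q) *\<^sub>v x"
    using Q(1) x by (simp add: v_eq)
  also have "\<dots> = x"
    using Q x by (simp add: orthonormal_cols_def)
  finally show ?thesis by (simp add: v_eq)
qed

lemma orthonormal_cols_projection_mat:
  assumes Q: "Q \<in> carrier_mat n m" "orthonormal_cols Q" and C: "C \<in> carrier_mat n k"
    and "set (cols C) \<subseteq> vec_space.col_space n Q"
  shows "Q * (Q\<^sup>T * C) = C"
proof (rule mat_col_eqI)
  fix i assume i: "i < dim_col C"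
  then have "col C i \<in> vec_space.col_space n Q"
    using assms(4) by (auto simp: cols_def)
  then have "col C i = Q *\<^sub>v (Q\<^sup>T *\<^sub>v col C i)"
    by (rule orthonormal_cols_projection[OF Q, symmetric])
  also have "Q\<^sup>T *\<^sub>v col C i = col (Q\<^sup>T * C) i"
    using Q C i by (intro col_mult2[symmetric, of _ m n _ k]) auto
  also have "Q *\<^sub>v col (Q\<^sup>T * C) i = col (Q * (Q\<^sup>T * C)) i"
    using Q C i by (intro col_mult2[symmetric, of _ n m _ k]) auto
  finally show "col (Q * (Q\<^sup>T * C)) i = col C i" ..
qed (use Q C in auto)

section \<open>QR factors, column operations, norms and the truncation rank\<close>

lemma qr_decompositionD:
  assumes "qr_decomposition M Q R" and "M \<in> carrier_mat n k"
  shows "Q \<in> carrier_mat n k" and "R \<in> carrier_mat k k" and "M = Q * R"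
  using assms(1) carrier_matD[OF assms(2)]
  by (simp_all only: qr_decomposition_def qr_factor_def)

lemma dim_hcat: "A \<in> carrier_mat n k \<Longrightarrow> B \<in> carrier_mat n l \<Longrightarrow> hcat A B \<in> carrier_mat n (k + l)"
  by (intro carrier_matI) (simp_all add: hcat_def)

lemma cols_hcat:
  assumes "A \<in> carrier_mat n k" and "B \<in> carrier_mat n l"
  shows "cols (hcat A B) = cols A @ cols B"
  using assms cols_dim[of A] cols_dim[of B] unfolding hcat_def
  by (intro cols_mat_of_cols) auto

lemma dim_prepend_col:
  "v \<in> carrier_vec n \<Longrightarrow> B \<in> carrier_mat n k \<Longrightarrow> prepend_col v B \<in> carrier_mat n (Suc k)"
  by (intro carrier_matI) (simp_all add: prepend_col_def)

lemma col_prepend_col_0: "v \<in> carrier_vec n \<Longrightarrow> col (prepend_col v B) 0 = v"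
  by (simp add: prepend_col_def)

lemma cols_prepend_col:
  assumes "v \<in> carrier_vec n" and "B \<in> carrier_mat n k"
  shows "cols (prepend_col v B) = v # cols B"
  using assms cols_dim[of B] carrier_vecD[OF assms(1)] unfolding prepend_col_def
  by (intro cols_mat_of_cols) auto

lemma prepend_col_index_0:
  "v \<in> carrier_vec n \<Longrightarrow> i < n \<Longrightarrow> prepend_col v B $$ (i, 0) = v $ i"
  by (simp add: prepend_col_def mat_of_cols_index)

lemma prepend_col_index_Suc:
  assumes "v \<in> carrier_vec n" and "B \<in> carrier_mat n k" and "i < n" and "j < k"
  shows "prepend_col v B $$ (i, Suc j) = B $$ (i, j)"
  using assms by (simp add: prepend_col_def mat_of_cols_index)

lemma dim_drop_first_col: "A \<in> carrier_mat n (Suc k) \<Longrightarrow> drop_first_col A \<in> carrier_mat n k"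
  by (intro carrier_matI) (simp_all add: drop_first_col_def)

lemma drop_first_col_index:
  assumes "A \<in> carrier_mat n (Suc k)" and "i < n" and "j < k"
  shows "drop_first_col A $$ (i, j) = A $$ (i, Suc j)"
  using assms by (simp add: drop_first_col_def mat_of_cols_index nth_tl)

lemma dim_take_cols: "A \<in> carrier_mat n m \<Longrightarrow> k \<le> m \<Longrightarrow> take_cols k A \<in> carrier_mat n k"
  by (intro carrier_matI) (simp_all add: take_cols_def)

lemma euclid_norm_unit_vec: "i < n \<Longrightarrow> euclid_norm (unit_vec n i) = 1"
  unfolding euclid_norm_def L2_set_def by (simp add: power2_eq_square sum.remove[of _ i])

lemma euclid_norm_eq_0: "euclid_norm v = 0 \<Longrightarrow> v = 0\<^sub>v (dim_vec v)"
  by (auto simp: euclid_norm_def L2_set_eq_0_iff)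

text \<open>At \<open>k = n\<close> the discarded sum is empty, so every nonnegative tolerance is
  met there and \<open>n\<close> bounds the least such rank.\<close>

lemma truncation_rank_le: "\<theta> \<ge> 0 \<Longrightarrow> truncation_rank n \<theta> sv \<le> n"
  unfolding truncation_rank_def by (rule Least_le) simp

section \<open>The low-rank solution as a matrix product\<close>

lemma solution_entry_eq:
  assumes "X \<in> carrier_mat n p" "S \<in> carrier_mat p q" "V \<in> carrier_mat N q" "j < n" "k < N"
  shows "solution_entry X S V j k = (X * S * V\<^sup>T) $$ (j, k)"
proof -
  have "(X * S * V\<^sup>T) $$ (j, k) = (X * (S * V\<^sup>T)) $$ (j, k)"
    using assms by simp
  also have "\<dots> = (\<Sum>l<p. X $$ (j, l) * (\<Sum>m<q. S $$ (l, m) * V $$ (k, m)))"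
    using assms by (simp add: scalar_prod_def atLeast0LessThan)
  also have "\<dots> = solution_entry X S V j k"
    using assms by (simp add: solution_entry_def sum_distrib_left mult.assoc)
  finally show ?thesis ..
qed

lemma scalar_flux_eq_solution_entry: "scalar_flux X S V j = solution_entry X S V j 0"
  by (simp add: scalar_flux_def solution_entry_def)

text \<open>Putting the bases around the projected core produces the projection of \<open>X0\<close>
  on the left and the transposed projection of \<open>V0\<close> on the right; both leave their
  argument fixed.\<close>

lemma S_projected_reconstruction:
  assumes "X0 \<in> carrier_mat nx r" "S0 \<in> carrier_mat r r" "V0 \<in> carrier_mat N r"
    and "Xs \<in> carrier_mat nx p" "Vs \<in> carrier_mat N q"
    and X: "Xs * (Xs\<^sup>T * X0) = X0" and V: "Vs * (Vs\<^sup>T * V0) = V0"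
  shows "Xs * S_projected X0 S0 V0 Xs Vs * Vs\<^sup>T = X0 * S0 * V0\<^sup>T"
proof -
  have "V0\<^sup>T * Vs * Vs\<^sup>T = (Vs * (Vs\<^sup>T * V0))\<^sup>T"
    using assms(1-5) by (simp add: transpose_mult_dim assoc_mult_mat_dim)
  also have "\<dots> = V0\<^sup>T"
    by (simp only: V)
  finally have V': "V0\<^sup>T * Vs * Vs\<^sup>T = V0\<^sup>T" .
  have "Xs * S_projected X0 S0 V0 Xs Vs * Vs\<^sup>T
      = Xs * (Xs\<^sup>T * X0) * S0 * (V0\<^sup>T * Vs * Vs\<^sup>T)"
    using assms(1-5)
    by (simp add: S_projected_def assoc_mult_mat_dim)
  then show ?thesis
    by (simp only: X V')
qed

text \<open>Applying the matrix to \<open>e1\<close> selects its zeroth column, while the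
  conservation law contains its zeroth row; symmetry identifies the two.\<close>

lemma angular_matrix_symmetric: "(angular_matrix N)\<^sup>T = angular_matrix N"
  by (rule eq_matI) (auto simp: angular_matrix_def mult.commute mult.left_commute)

section \<open>The corrected coefficient matrix\<close>

lemma outer_prod_mult_vec:
  assumes "u \<in> carrier_vec n" "w \<in> carrier_vec m" "v \<in> carrier_vec m"
  shows "outer_prod u w *\<^sub>v v = (w \<bullet> v) \<cdot>\<^sub>v u"
  using assms
  by (intro eq_vecI) (auto simp: outer_prod_def scalar_prod_def sum_distrib_left mult_ac
      intro!: sum.cong)

text \<open>The projection by \<open>1 - e\<^sub>1 e\<^sub>1\<^sup>T\<close> removes the low-rank part from the zeroth moment, so the
  first column only sees the macroscopic update.\<close>

lemma S_corrected_first_col: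
  assumes Xs: "Xs \<in> carrier_mat nx p" and Sscat: "Sscat \<in> carrier_mat p q"
    and Vscat: "Vscat \<in> carrier_mat N q" and u: "u \<in> carrier_vec nx"
    and Xt1: "Xt1 \<in> carrier_mat nx k" and Vt1: "Vt1 \<in> carrier_mat N l"
    and "0 < N" "0 < l" and e1: "col Vt1 0 = unit_vec N 0"
  shows "col (S_corrected Xs Sscat Vscat u Xt1 Vt1) 0 = Xt1\<^sup>T *\<^sub>v u"
proof -
  let ?e = "unit_vec N 0 :: real vec"
  let ?G = "Xt1\<^sup>T * Xs * Sscat * Vscat\<^sup>T" and ?I = "1\<^sub>m N - outer_prod ?e ?e"
  have oe: "outer_prod ?e ?e \<in> carrier_mat N N" and ou: "outer_prod u ?e \<in> carrier_mat nx N"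
    using u by (auto simp: outer_prod_def)
  have I: "?I \<in> carrier_mat N N" using oe by (rule minus_carrier_mat)
  have G: "?G \<in> carrier_mat k N"
    using Xt1 Xs Sscat Vscat by auto
  have ee: "?e \<bullet> ?e = 1"
    using \<open>0 < N\<close> by simp
  have "?I *\<^sub>v ?e = 1\<^sub>m N *\<^sub>v ?e - outer_prod ?e ?e *\<^sub>v ?e"
    by (rule minus_mult_distrib_mat_vec[OF _ oe]) auto
  also have "\<dots> = 0\<^sub>v N"
    using ee by (simp add: outer_prod_mult_vec[of _ N _ N])
  finally have zero: "?I *\<^sub>v ?e = 0\<^sub>v N" .
  have "col (S_corrected Xs Sscat Vscat u Xt1 Vt1) 0
      = col (?G * ?I * Vt1) 0 + col (Xt1\<^sup>T * outer_prod u ?e * Vt1) 0"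
    using G I Xt1 ou Vt1 Vscat \<open>0 < l\<close> unfolding S_corrected_def Let_def
    by (intro eq_vecI) auto
  \<comment> \<open>Column 0 of a product is the left factor applied to column 0 of
    \<open>Vt1\<close>, which is \<open>?e\<close>.\<close>
  also have "col (?G * ?I * Vt1) 0 = ?G *\<^sub>v (?I *\<^sub>v ?e)"
    using G I Vt1 \<open>0 < l\<close> e1
    by (subst col_mult2[of _ k N _ l]) auto
  also have "col (Xt1\<^sup>T * outer_prod u ?e * Vt1) 0 = Xt1\<^sup>T *\<^sub>v (outer_prod u ?e *\<^sub>v ?e)"
    using Xt1 ou Vt1 \<open>0 < l\<close> e1
    by (subst col_mult2[of _ k N _ l]) auto
  also have "outer_prod u ?e *\<^sub>v ?e = u"
    using u ee by (simp add: outer_prod_mult_vec[of _ nx _ N])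
  also have "?G *\<^sub>v (?I *\<^sub>v ?e) = 0\<^sub>v k"
    unfolding zero by (rule mult_mat_zero_vec[OF G])
  finally show ?thesis
    using Xt1 u by simp
qed

section \<open>Conservative truncation preserves the zeroth moment\<close>

text \<open>The factors of the two final QR decompositions recombine, so the truncated solution is
  \<open>P * D * E\<^sup>T\<close>. Row 0 of \<open>E\<close> is a unit vector, hence column 0 is
  \<open>euclid_norm Kcons\<close> times the first column \<open>Xcons\<close> of \<open>P\<close>,
  which is \<open>Kcons\<close> again. The new rank \<open>k\<close> is \<open>Suc r1\<close>: the
  conserved column and the \<open>r1\<close> retained ones.\<close>

lemma conservative_truncation_first_col:
  assumes trunc: "conservative_truncation r \<theta> Xt1 St1 Vt1 X1 S1 V1"
    and Xt1: "Xt1 \<in> carrier_mat nx (Suc (2 * r))" and St1: "St1 \<in> carrier_mat (Suc (2 * r)) (Suc (2 * r))"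
    and Vt1: "Vt1 \<in> carrier_mat N (Suc (2 * r))" "orthonormal_cols Vt1"
    and e1: "col Vt1 0 = unit_vec N 0" and "0 < N" and "\<theta> \<ge> 0"
  obtains k where "X1 \<in> carrier_mat nx k" "S1 \<in> carrier_mat k k" "V1 \<in> carrier_mat N k"
    "col (X1 * S1 * V1\<^sup>T) 0 = Xt1 *\<^sub>v col St1 0"
proof -
  let ?e = "unit_vec N 0 :: real vec"
  define Kcons where "Kcons = col (Xt1 * St1) 0"
  define Krem where "Krem = drop_first_col (Xt1 * St1)"
  define Vrem_t where "Vrem_t = drop_first_col Vt1"
  have K: "Xt1 * St1 \<in> carrier_mat nx (Suc (2 * r))"
    using Xt1 St1 by simp
  obtain Xcons Xrem_t Srem_t U sv W R1 R2 where
    Xcons: "Xcons \<in> carrier_vec nx" "Kcons \<noteq> 0\<^sub>v nx \<longrightarrow> Xcons = (1 / euclid_norm Kcons) \<cdot>\<^sub>v Kcons"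
    and Krem_qr: "qr_decomposition Krem Xrem_t Srem_t"
    and svd: "sv_decomposition (2 * r) Srem_t U sv W"
    and X1: "qr_decomposition
          (prepend_col Xcons (Xrem_t * take_cols (truncation_rank (2 * r) \<theta> sv) U)) X1 R1"
    and V1: "qr_decomposition
          (prepend_col ?e (Vrem_t * take_cols (truncation_rank (2 * r) \<theta> sv) W)) V1 R2"
    and S1: "S1 = R1 * four_block_mat (mat 1 1 (\<lambda>_. euclid_norm Kcons))
          (0\<^sub>m 1 (truncation_rank (2 * r) \<theta> sv)) (0\<^sub>m (truncation_rank (2 * r) \<theta> sv) 1)
          (mat_diag (truncation_rank (2 * r) \<theta> sv) sv) * R2\<^sup>T"
    using trunc
    unfolding conservative_truncation_def Let_def Kcons_def Krem_def Vrem_t_def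
      carrier_matD(1)[OF Xt1] carrier_matD(1)[OF Vt1(1)]
    by (elim exE conjE) blast
  define r1 where "r1 = truncation_rank (2 * r) \<theta> sv"
  define P where "P = prepend_col Xcons (Xrem_t * take_cols r1 U)"
  define E where "E = prepend_col ?e (Vrem_t * take_cols r1 W)"
  define D where "D = four_block_mat (mat 1 1 (\<lambda>_. euclid_norm Kcons))
          (0\<^sub>m 1 r1) (0\<^sub>m r1 1) (mat_diag r1 sv)"
  have r1: "r1 \<le> 2 * r"
    using truncation_rank_le[OF \<open>\<theta> \<ge> 0\<close>] by (simp add: r1_def)
  have "Krem \<in> carrier_mat nx (2 * r)"
    unfolding Krem_def by (rule dim_drop_first_col[OF K])
  with Krem_qr have Xrem_t: "Xrem_t \<in> carrier_mat nx (2 * r)"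
    by (rule qr_decompositionD)
  have UW: "take_cols r1 U \<in> carrier_mat (2 * r) r1" "take_cols r1 W \<in> carrier_mat (2 * r) r1"
    using svd r1 by (auto simp: sv_decomposition_def intro: dim_take_cols)
  have Vrem_t: "Vrem_t \<in> carrier_mat N (2 * r)"
    unfolding Vrem_t_def by (rule dim_drop_first_col[OF Vt1(1)])
  have Vrem: "Vrem_t * take_cols r1 W \<in> carrier_mat N r1"
    using Vrem_t UW by simp
  have P: "P \<in> carrier_mat nx (Suc r1)"
    unfolding P_def using Xcons(1) Xrem_t UW by (intro dim_prepend_col) auto
  have E: "E \<in> carrier_mat N (Suc r1)"
    unfolding E_def using Vrem by (intro dim_prepend_col) auto
  have D: "D \<in> carrier_mat (Suc r1) (Suc r1)"
    unfolding D_def by (intro carrier_matI) (simp_all add: mat_diag_def)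
  have X1: "X1 \<in> carrier_mat nx (Suc r1)" "R1 \<in> carrier_mat (Suc r1) (Suc r1)" "P = X1 * R1"
    using X1 qr_decompositionD[OF _ P] unfolding P_def r1_def by blast+
  have V1: "V1 \<in> carrier_mat N (Suc r1)" "R2 \<in> carrier_mat (Suc r1) (Suc r1)" "E = V1 * R2"
    using V1 qr_decompositionD[OF _ E] unfolding E_def r1_def by blast+
  have S1: "S1 = R1 * D * R2\<^sup>T"
    using S1 by (simp add: D_def r1_def)
  have "X1 * S1 * V1\<^sup>T = P * (D * E\<^sup>T)"
    using X1 V1 D unfolding S1
    by (simp add: transpose_mult_dim assoc_mult_mat_dim)
  then have "col (X1 * S1 * V1\<^sup>T) 0 = P *\<^sub>v col (D * E\<^sup>T) 0"
    using P D E \<open>0 < N\<close> col_mult2[of P nx "Suc r1" "D * E\<^sup>T" N 0] by simp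
  also have "col (D * E\<^sup>T) 0 = D *\<^sub>v col E\<^sup>T 0"
    using D E \<open>0 < N\<close> by (intro col_mult2[of _ "Suc r1" "Suc r1" _ N]) auto
  \<comment> \<open>These are the zeroth moments of the columns of \<open>E\<close>: 1 for the
    prepended \<open>e1\<close>, and 0 for the others, which are combinations of columns of
    \<open>Vt1\<close> orthogonal to \<open>e1\<close>.\<close>
  also have "col E\<^sup>T 0 = unit_vec (Suc r1) 0"
  proof (rule eq_vecI)
    \<comment> \<open>Since column 0 of \<open>Vt1\<close> is \<open>e1\<close>, an entry of row 0
      is an entry of the Gram matrix of \<open>Vt1\<close>, and here an off-diagonal one.\<close>
    have Vt1_row: "Vt1 $$ (0, Suc j) = 0" if "j < 2 * r" for j
    proof -
      have "Vt1 $$ (0, Suc j) = col Vt1 0 \<bullet> col Vt1 (Suc j)"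
        using that Vt1(1) \<open>0 < N\<close> scalar_prod_left_unit[of "col Vt1 (Suc j)" N 0]
        by (simp add: e1 carrier_vecI)
      also have "\<dots> = (Vt1\<^sup>T * Vt1) $$ (0, Suc j)"
        using that Vt1(1) by simp
      also have "\<dots> = 0"
        using that Vt1 by (simp add: orthonormal_cols_def)
      finally show ?thesis .
    qed
    have "(Vrem_t * take_cols r1 W) $$ (0, j) = 0" if "j < r1" for j
      using that Vrem_t UW Vt1(1) \<open>0 < N\<close> Vt1_row
      by (simp add: scalar_prod_def Vrem_t_def drop_first_col_index)
    then have "E $$ (0, i) = unit_vec (Suc r1) 0 $ i" if "i < Suc r1" for i
      using that \<open>0 < N\<close>
      by (cases i) (simp_all add: E_def prepend_col_index_0[of _ N]
          prepend_col_index_Suc[OF unit_vec_carrier Vrem])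
    then show "col E\<^sup>T 0 $ i = unit_vec (Suc r1) 0 $ i" if "i < dim_vec (unit_vec (Suc r1) 0)" for i
      using that E \<open>0 < N\<close> by simp
  qed (use E in simp)
  also have "D *\<^sub>v unit_vec (Suc r1) 0 = euclid_norm Kcons \<cdot>\<^sub>v unit_vec (Suc r1) 0"
    using D by (intro eq_vecI) (auto simp: mult_mat_unit_vec D_def mat_diag_def)
  also have "P *\<^sub>v (euclid_norm Kcons \<cdot>\<^sub>v unit_vec (Suc r1) 0) = euclid_norm Kcons \<cdot>\<^sub>v col P 0"
    using P by (simp add: mult_mat_vec[of _ nx "Suc r1"] mult_mat_unit_vec)
  also have "col P 0 = Xcons"
    unfolding P_def by (rule col_prepend_col_0[OF Xcons(1)])
  \<comment> \<open>If \<open>Kcons\<close> vanishes, \<open>Xcons\<close> is an arbitrary unit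
    vector, but its weight is 0; otherwise the weight undoes the normalization.\<close>
  also have "euclid_norm Kcons \<cdot>\<^sub>v Xcons = Kcons"
  proof (cases "Kcons = 0\<^sub>v nx")
    case True
    then show ?thesis using Xcons(1) by (auto simp: euclid_norm_def L2_set_def)
  next
    case False
    have "dim_vec Kcons = nx"
      using Xt1 by (simp add: Kcons_def)
    then have "euclid_norm Kcons \<noteq> 0"
      using False euclid_norm_eq_0 by metis
    then show ?thesis
      using False Xcons(2) by (simp add: smult_smult_assoc)
  qed
  also have "Kcons = Xt1 *\<^sub>v col St1 0"
    using Xt1 St1 unfolding Kcons_def by (subst col_mult2) auto
  finally have "col (X1 * S1 * V1\<^sup>T) 0 = Xt1 *\<^sub>v col St1 0" .
  moreover have "S1 \<in> carrier_mat (Suc r1) (Suc r1)"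
    using X1 V1 D by (simp add: S1)
  ultimately show ?thesis
    using that X1 V1 by blast
qed

section \<open>Local conservation for one step\<close>

theorem theorem4:
  fixes nx N r :: nat and dx \<sigma> dt \<theta> :: real
    and A absA Q M Dx Dxx :: "real mat"
    and X0 S0 V0 X1 S1 V1 :: "real mat" and B0 B1 :: "real vec"
  assumes "2 * r + 1 \<le> min nx N"
    and "dx > 0" and "\<sigma> > 0" and "dt > 0" and "\<theta> \<ge> 0"
    and "A = angular_matrix N"
    and "orthogonal_diagonalization N A Q M"
    and "absA = Q * map_mat abs M * Q\<^sup>T"
    and "Dx = Dx_mat nx dx" and "Dxx = Dxx_mat nx dx"
    and "X0 \<in> carrier_mat nx r" and "orthonormal_cols X0"
    and "V0 \<in> carrier_mat N r" and "orthonormal_cols V0"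
    and "S0 \<in> carrier_mat r r" and "B0 \<in> carrier_vec nx"
    and "scheme_step nx N r \<sigma> dt \<theta> Dx Dxx A absA X0 S0 V0 B0 X1 S1 V1 B1"
  shows "\<forall>j<nx.
      scalar_flux X1 S1 V1 j =
        scalar_flux X0 S0 V0 j
        - dt * (\<Sum>i<nx. \<Sum>l<N. Dx $$ (j, i) * solution_entry X0 S0 V0 i l * A $$ (0, l))
        + dt * (\<Sum>i<nx. \<Sum>l<N. Dxx $$ (j, i) * solution_entry X0 S0 V0 i l * absA $$ (0, l))
        + \<sigma> * dt * (B1 $ j - scalar_flux X1 S1 V1 j)
    \<and> B1 $ j = B0 $ j + \<sigma> * dt * (scalar_flux X1 S1 V1 j - B1 $ j)"
proof -
  have N: "0 < N"
    using assms(1) by simp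
  note A = assms(6) and Q = assms(7) and absA = assms(8) and Dx = assms(9) and Dxx = assms(10)
    and X0 = assms(11) and V0 = assms(13) and S0 = assms(15) and B0 = assms(16)
  have A_carrier: "A \<in> carrier_mat N N" and A_sym: "A\<^sup>T = A"
    using angular_matrix_symmetric by (auto simp: A angular_matrix_def)
  have QM: "Q \<in> carrier_mat N N" "M \<in> carrier_mat N N" "diagonal_mat M"
    using Q by (auto simp: orthogonal_diagonalization_def)
  \<comment> \<open>Off the diagonal both entries vanish, so a diagonal matrix equals its
    transpose.\<close>
  have "(map_mat abs M)\<^sup>T = map_mat abs M"
    using QM by (intro eq_matI) (auto simp: diagonal_mat_def, metis)
  then have absA_sym: "absA\<^sup>T = absA"
    unfolding absA using QM by (intro symmetric_congruence) auto
  have absA_carrier: "absA \<in> carrier_mat N N"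
    using QM by (simp add: absA)
  have D_carrier: "Dx \<in> carrier_mat nx nx" "Dxx \<in> carrier_mat nx nx"
    by (simp_all add: Dx Dxx Dx_mat_def Dxx_mat_def)
  obtain Xs Vs Ss St0 u Vscat Sscat Xt1 Vt1 St1 where
    Xs: "qr_factor (hcat (K_step dt Dx Dxx A absA X0 S0 V0) X0) Xs"
    and Vs: "qr_factor (hcat (L_step dt Dx Dxx A absA X0 S0 V0) V0) Vs"
    and St0: "St0 = S_projected X0 S0 V0 Xs Vs"
    and Ss: "Ss = S_step dt Dx Dxx A absA Xs St0 Vs"
    and coupled: "coupled_implicit_system \<sigma> dt Dx Dxx A absA X0 S0 V0 Xs St0 Vs B0 u B1"
    and Sscat: "Sscat \<in> carrier_mat (2 * r) (2 * r)"
    and Vscat: "qr_decomposition (L_scat \<sigma> dt (Vs * Ss\<^sup>T)) Vscat (Sscat\<^sup>T)"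
    and Xt1: "qr_factor (prepend_col u Xs) Xt1"
    and Vt1: "qr_factor (prepend_col (unit_vec N 0) Vscat) Vt1"
    and St1: "St1 = S_corrected Xs Sscat Vscat u Xt1 Vt1"
    and trunc: "conservative_truncation r \<theta> Xt1 St1 Vt1 X1 S1 V1"
    using assms(17) unfolding scheme_step_def by blast
  define e1 where "e1 = (unit_vec N 0 :: real vec)"
  define F where "F = X0 * S0 * V0\<^sup>T"
  have F: "F \<in> carrier_mat nx N"
    using X0 V0 S0 by (simp add: F_def)
  have K: "K_step dt Dx Dxx A absA X0 S0 V0 \<in> carrier_mat nx r"
    and L: "L_step dt Dx Dxx A absA X0 S0 V0 \<in> carrier_mat N r"
    using X0 V0 S0 D_carrier A_carrier absA_carrier
    by (auto simp: K_step_def L_step_def Let_def)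
  \<comment> \<open>\<open>X0\<close> is one block of the factored matrix, so its columns lie in the
    span of the QR factor; likewise for \<open>V0\<close> below.\<close>
  have Xs_carrier: "Xs \<in> carrier_mat nx (2 * r)" and Xs_orth: "orthonormal_cols Xs"
    and Xs_span: "set (cols X0) \<subseteq> vec_space.col_space nx Xs"
    using Xs dim_hcat[OF K X0] cols_hcat[OF K X0] by (auto simp: qr_factor_def mult_2)
  have Vs_carrier: "Vs \<in> carrier_mat N (2 * r)" and Vs_orth: "orthonormal_cols Vs"
    and Vs_span: "set (cols V0) \<subseteq> vec_space.col_space N Vs"
    using Vs dim_hcat[OF L V0] cols_hcat[OF L V0] by (auto simp: qr_factor_def mult_2)
  have St0_carrier: "St0 \<in> carrier_mat (2 * r) (2 * r)"
    using Xs_carrier Vs_carrier by (intro carrier_matI) (simp_all add: St0 S_projected_def)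
  have F_eq: "Xs * St0 * Vs\<^sup>T = F"
    unfolding St0 F_def
    by (rule S_projected_reconstruction[OF X0 S0 V0 Xs_carrier Vs_carrier])
      (rule orthonormal_cols_projection_mat[OF Xs_carrier Xs_orth X0 Xs_span]
        orthonormal_cols_projection_mat[OF Vs_carrier Vs_orth V0 Vs_span])+
  \<comment> \<open>A generic stencil \<open>D\<close> and a generic symmetric \<open>C\<close>
    cover both the advection term with \<open>Dx\<close>, \<open>A\<close> and the stabilization
    term with \<open>Dxx\<close>, \<open>absA\<close>.\<close>
  have flux_term: "((D * Xs * St0 * Vs\<^sup>T * C) *\<^sub>v e1) $ j =
      (\<Sum>i<nx. \<Sum>l<N. D $$ (j, i) * solution_entry X0 S0 V0 i l * C $$ (0, l))"
    if D: "D \<in> carrier_mat nx nx" and C: "C \<in> carrier_mat N N" "C\<^sup>T = C" and j: "j < nx" for C D j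
  proof -
    have C_sym: "C $$ (l, 0) = C $$ (0, l)" if "l < N" for l
      using C that N by (metis carrier_matD index_transpose_mat(1))
    have "D * Xs * St0 * Vs\<^sup>T * C = D * (F * C)"
      using D C Xs_carrier St0_carrier Vs_carrier unfolding F_eq[symmetric]
      by (simp add: assoc_mult_mat_dim)
    then have "((D * Xs * St0 * Vs\<^sup>T * C) *\<^sub>v e1) $ j = (D * (F * C)) $$ (j, 0)"
      using D F C N j unfolding e1_def by (subst mult_mat_unit_vec[of _ nx]) auto
    also have "\<dots> = (\<Sum>i<nx. D $$ (j, i) * (\<Sum>l<N. F $$ (i, l) * C $$ (l, 0)))"
      using D F C N j by (simp add: scalar_prod_def atLeast0LessThan)
    also have "\<dots> = (\<Sum>i<nx. \<Sum>l<N. D $$ (j, i) * solution_entry X0 S0 V0 i l * C $$ (0, l))"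
      using C_sym solution_entry_eq[OF X0 S0 V0]
      by (simp add: sum_distrib_left F_def mult.assoc)
    finally show ?thesis .
  qed
  have u: "u \<in> carrier_vec nx" and B1: "B1 \<in> carrier_vec nx"
    and u_eq: "u = F *\<^sub>v e1
          - dt \<cdot>\<^sub>v ((Dx * Xs * St0 * Vs\<^sup>T * A) *\<^sub>v e1)
          + dt \<cdot>\<^sub>v ((Dxx * Xs * St0 * Vs\<^sup>T * absA) *\<^sub>v e1)
          + (\<sigma> * dt) \<cdot>\<^sub>v (B1 - u)"
    and B1_eq: "B1 = B0 + (\<sigma> * dt) \<cdot>\<^sub>v (u - B1)"
    using coupled X0 V0 unfolding coupled_implicit_system_def Let_def F_def e1_def by auto
  have "Vs * Ss\<^sup>T \<in> carrier_mat N (2 * r)"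
    using Xs_carrier Vs_carrier St0_carrier D_carrier A_carrier absA_carrier
    by (auto simp: Ss S_step_def)
  then have "L_scat \<sigma> dt (Vs * Ss\<^sup>T) \<in> carrier_mat N (2 * r)"
    unfolding L_scat_def by (intro carrier_matI) (simp_all only: dim_row_mat dim_col_mat carrier_matD)
  then have Vscat_carrier: "Vscat \<in> carrier_mat N (2 * r)"
    by (rule qr_decompositionD(1)[OF Vscat])
  \<comment> \<open>Prepending \<open>u\<close> before the QR step puts it into the span of
    \<open>Xt1\<close>, even when \<open>u\<close> is zero.\<close>
  have Xt1_carrier: "Xt1 \<in> carrier_mat nx (Suc (2 * r))" and Xt1_orth: "orthonormal_cols Xt1"
    and u_span: "u \<in> vec_space.col_space nx Xt1"
    using Xt1 dim_prepend_col[OF u Xs_carrier] cols_prepend_col[OF u Xs_carrier]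
    by (auto simp: qr_factor_def)
  have e1: "e1 \<in> carrier_vec N" "e1 \<noteq> 0\<^sub>v N" "euclid_norm e1 = 1"
    using N by (simp_all add: e1_def euclid_norm_unit_vec)
  \<comment> \<open>The QR convention normalizes a nonzero first column; \<open>e1\<close> already
    has norm 1 and is therefore kept exactly.\<close>
  have Vt1_carrier: "Vt1 \<in> carrier_mat N (Suc (2 * r))" and Vt1_orth: "orthonormal_cols Vt1"
    and Vt1_col: "col Vt1 0 = unit_vec N 0"
    using Vt1 e1 dim_prepend_col[OF e1(1) Vscat_carrier] col_prepend_col_0[OF e1(1)]
    by (auto simp: qr_factor_def e1_def[symmetric])
  have St1_carrier: "St1 \<in> carrier_mat (Suc (2 * r)) (Suc (2 * r))"
    using Xt1_carrier Vt1_carrier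
    by (intro carrier_matI) (simp_all add: St1 S_corrected_def Let_def)
  obtain k where X1: "X1 \<in> carrier_mat nx k" and S1: "S1 \<in> carrier_mat k k"
    and V1: "V1 \<in> carrier_mat N k"
    and col1: "col (X1 * S1 * V1\<^sup>T) 0 = Xt1 *\<^sub>v col St1 0"
    using conservative_truncation_first_col[OF trunc Xt1_carrier St1_carrier Vt1_carrier Vt1_orth
        Vt1_col N assms(5)] by blast
  have "col St1 0 = Xt1\<^sup>T *\<^sub>v u"
    unfolding St1
    by (rule S_corrected_first_col[OF Xs_carrier Sscat Vscat_carrier u Xt1_carrier Vt1_carrier
          N _ Vt1_col]) simp
  \<comment> \<open>The coordinates of \<open>u\<close> in the basis \<open>Xt1\<close> are mapped
    back to \<open>u\<close> because \<open>u\<close> lies in its span.\<close>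
  with col1 have col1: "col (X1 * S1 * V1\<^sup>T) 0 = u"
    using orthonormal_cols_projection[OF Xt1_carrier Xt1_orth u_span] by simp
  have flux1: "scalar_flux X1 S1 V1 j = u $ j" if "j < nx" for j
    using that N X1 S1 V1 solution_entry_eq[OF X1 S1 V1 that N]
    by (simp add: scalar_flux_eq_solution_entry flip: col1)
  have flux0: "(F *\<^sub>v e1) $ j = scalar_flux X0 S0 V0 j" if "j < nx" for j
    using that N F solution_entry_eq[OF X0 S0 V0 that N] mult_mat_unit_vec[OF F N]
    by (simp add: scalar_flux_eq_solution_entry e1_def flip: F_def)
  show ?thesis
  proof (intro allI impI conjI)
    fix j assume j: "j < nx"
    have dims: "dim_row (Dx * Xs * St0 * Vs\<^sup>T * A) = nx" "dim_row (Dxx * Xs * St0 * Vs\<^sup>T * absA) = nx"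
      using D_carrier by auto
    \<comment> \<open>The equation is implicit, with \<open>u\<close> on both sides, so it is
      substituted once, on the left. The matrix products stay folded to match
      \<open>flux_term\<close>, with their row counts supplied by \<open>dims\<close>.\<close>
    have "u $ j = (F *\<^sub>v e1) $ j - dt * ((Dx * Xs * St0 * Vs\<^sup>T * A) *\<^sub>v e1) $ j
        + dt * ((Dxx * Xs * St0 * Vs\<^sup>T * absA) *\<^sub>v e1) $ j + \<sigma> * dt * (B1 $ j - u $ j)"
      using j u B1 F dims
      by (subst u_eq) (simp del: index_mult_mat index_mult_mat_vec)
    then show "scalar_flux X1 S1 V1 j =
        scalar_flux X0 S0 V0 j
        - dt * (\<Sum>i<nx. \<Sum>l<N. Dx $$ (j, i) * solution_entry X0 S0 V0 i l * A $$ (0, l))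
        + dt * (\<Sum>i<nx. \<Sum>l<N. Dxx $$ (j, i) * solution_entry X0 S0 V0 i l * absA $$ (0, l))
        + \<sigma> * dt * (B1 $ j - scalar_flux X1 S1 V1 j)"
      using flux_term[OF D_carrier(1) A_carrier A_sym j]
        flux_term[OF D_carrier(2) absA_carrier absA_sym j]
      by (simp only: flux1[OF j] flux0[OF j])
    have "B1 $ j = (B0 + (\<sigma> * dt) \<cdot>\<^sub>v (u - B1)) $ j"
      using B1_eq by simp
    then show "B1 $ j = B0 $ j + \<sigma> * dt * (scalar_flux X1 S1 V1 j - B1 $ j)"
      using j u B1 B0 by (simp add: flux1[OF j])
  qed
qed

end
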